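(* For every integer $n\ge 2$, the fan graph $F_n$ does not have a canonical ESD labeling if and only if $n\ge 8$.
   Context: The fan graph $F_n$ consists of a path $P_{n-1}$ on $n-1$ vertices together with one additional vertex (the central vertex) joined by an edge to every vertex of the path; it has $n$ vertices. For a graph $G=(V,E)$ and $l\in\mathbb N$, a vertex labeling $\phi:V\to\{1,\dots,l\}$ is an edge-sum distinguishing (ESD) labeling if $\phi$ is injective and the edge-weights $w_\phi(uv)=\phi(u)+\phi(v)$ are pairwise distinct over all edges $uv\in E$. It is a canonical ESD labeling if $l=|V|$. *)

theory Defs
  imports Main
begin

text \<open>
  A finite simple graph is given by its vertex set \<open>V\<close> and its edge set \<open>E\<close>, the edges being
  two-element subsets of \<open>V\<close>.  (In a symmetric digraph every edge would occur as two arcs of equal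
  weight, so that weights could never be pairwise distinct.)
\<close>

definition edge_weight :: "('a \<Rightarrow> nat) \<Rightarrow> 'a set \<Rightarrow> nat" where
  "edge_weight \<phi> e = (\<Sum>v\<in>e. \<phi> v)"

lemma edge_weight_edge [simp]: "u \<noteq> v \<Longrightarrow> edge_weight \<phi> {u, v} = \<phi> u + \<phi> v"
  by (simp add: edge_weight_def)

definition ESD_labeling :: "'a set \<Rightarrow> 'a set set \<Rightarrow> nat \<Rightarrow> ('a \<Rightarrow> nat) \<Rightarrow> bool" where
  "ESD_labeling V E l \<phi> \<longleftrightarrow>
     \<phi> ` V \<subseteq> {1..l} \<and> inj_on \<phi> V \<and> inj_on (edge_weight \<phi>) E"

definition canonical_ESD_labeling :: "'a set \<Rightarrow> 'a set set \<Rightarrow> ('a \<Rightarrow> nat) \<Rightarrow> bool" where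
  "canonical_ESD_labeling V E \<phi> \<longleftrightarrow> ESD_labeling V E (card V) \<phi>"

definition path_verts :: "nat \<Rightarrow> nat set" where
  "path_verts m = {1..m}"

definition path_edges :: "nat \<Rightarrow> nat set set" where
  "path_edges m = {{i, i + 1} | i. 1 \<le> i \<and> i + 1 \<le> m}"

text \<open>The central vertex of the fan is \<open>0\<close>, which is not a vertex of the path.\<close>

definition fan_verts :: "nat \<Rightarrow> nat set" where
  "fan_verts n = insert 0 (path_verts (n - 1))"

definition fan_edges :: "nat \<Rightarrow> nat set set" where
  "fan_edges n = path_edges (n - 1) \<union> {{0, v} | v. v \<in> path_verts (n - 1)}"

lemma card_fan_verts: "n \<ge> 1 \<Longrightarrow> card (fan_verts n) = n"
  by (simp add: fan_verts_def path_verts_def)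

lemma fan_edges_simple: "e \<in> fan_edges n \<Longrightarrow> e \<subseteq> fan_verts n \<and> card e = 2"
  by (auto simp: fan_edges_def fan_verts_def path_edges_def path_verts_def)

end

theory Submission
  imports Defs
begin

text \<open>
  A fan with \<open>n\<close> vertices has \<open>2 * n - 3\<close> edges, and the sum of two distinct labels from \<open>{1..n}\<close>
  lies in \<open>{3..2 * n - 1}\<close>, so a canonical ESD labeling attains each of these weights exactly once.
  If the central label is at least 5, the weights 3, 4, 5 come from path edges: weights 3 and 4 force
  labels 2 and 3 to be the two path neighbours of label 1, and weight 5, being \<open>1 + 4\<close> or \<open>2 + 3\<close>,
  then requires a third neighbour of label 1 or closes a triangle.  Replacing each label \<open>k\<close> by
  \<open>n + 1 - k\<close> shows that the central label is also at least \<open>n - 3\<close>, so \<open>n \<le> 7\<close>.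
\<close>

text \<open>The bound by \<open>k\<close> keeps natural subtraction exact, so each vertex
  contributes \<open>k\<close> to the total. Writing the result as a sum avoids a truncated
  difference of weights.\<close>

lemma edge_weight_complement:
  assumes "finite e" "\<And>v. v \<in> e \<Longrightarrow> \<phi> v \<le> k"
  shows "edge_weight (\<lambda>v. k - \<phi> v) e + edge_weight \<phi> e = card e * k"
proof -
  have "edge_weight (\<lambda>v. k - \<phi> v) e + edge_weight \<phi> e = (\<Sum>v\<in>e. k - \<phi> v + \<phi> v)"
    by (simp add: edge_weight_def sum.distrib)
  also have "\<dots> = (\<Sum>v\<in>e. k)"
    using assms(2) by (intro sum.cong) auto
  finally show ?thesis by simp
qed

text \<open>Reversal of the labels turns weight \<open>w\<close> into
  \<open>2 * (l + 1) - w\<close>, which preserves distinctness. It turns an upper bound on the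
  central label into a lower bound.\<close>

lemma ESD_labeling_complement:
  assumes "ESD_labeling V E l \<phi>" and simple: "\<And>e. e \<in> E \<Longrightarrow> e \<subseteq> V \<and> card e = 2"
  shows "ESD_labeling V E l (\<lambda>v. l + 1 - \<phi> v)"
proof -
  have img: "\<phi> ` V \<subseteq> {1..l}" and inj: "inj_on \<phi> V" and injE: "inj_on (edge_weight \<phi>) E"
    using assms(1) by (auto simp: ESD_labeling_def)
  have bound: "1 \<le> \<phi> v \<and> \<phi> v \<le> l" if "v \<in> V" for v
    using img that by auto
  have weight: "edge_weight (\<lambda>v. l + 1 - \<phi> v) e + edge_weight \<phi> e = 2 * (l + 1)" if "e \<in> E" for e
  proof -
    have "finite e"
      using simple[OF that] by (metis card.infinite zero_neq_numeral)
    moreover have "\<phi> v \<le> l + 1" if "v \<in> e" for v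
      using bound simple[OF \<open>e \<in> E\<close>] that by (meson le_add1 le_trans subsetD)
    ultimately show ?thesis
      using edge_weight_complement[of e \<phi> "l + 1"] simple[OF that] by simp
  qed
  have "(\<lambda>v. l + 1 - \<phi> v) ` V \<subseteq> {1..l}"
    using bound by fastforce
  moreover have "inj_on (\<lambda>v. l + 1 - \<phi> v) V"
  proof (rule inj_onI)
    fix u v assume "u \<in> V" "v \<in> V" "l + 1 - \<phi> u = l + 1 - \<phi> v"
    then have "\<phi> u = \<phi> v"
      using bound[of u] bound[of v] by linarith
    then show "u = v"
      using inj \<open>u \<in> V\<close> \<open>v \<in> V\<close> by (auto dest: inj_onD)
  qed
  moreover have "inj_on (edge_weight (\<lambda>v. l + 1 - \<phi> v)) E"
  proof (rule inj_onI)
    fix d e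
    assume "d \<in> E" "e \<in> E"
      and "edge_weight (\<lambda>v. l + 1 - \<phi> v) d = edge_weight (\<lambda>v. l + 1 - \<phi> v) e"
    then have "edge_weight \<phi> d = edge_weight \<phi> e"
      using weight[of d] weight[of e] by linarith
    then show "d = e"
      using injE \<open>d \<in> E\<close> \<open>e \<in> E\<close> by (auto dest: inj_onD)
  qed
  ultimately show ?thesis by (simp add: ESD_labeling_def)
qed

text \<open>Endpoints carry distinct labels, so the extreme sums are \<open>1 + 2\<close> and
  \<open>(l - 1) + l\<close>.\<close>

lemma ESD_labeling_weight_bounds:
  assumes "ESD_labeling V E l \<phi>" "e \<in> E" "e \<subseteq> V" "card e = 2"
  shows "edge_weight \<phi> e \<in> {3..2 * l - 1}"
proof -
  obtain u v where e: "e = {u, v}" "u \<noteq> v"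
    using assms(4) by (auto simp: card_2_iff)
  have "u \<in> V" "v \<in> V"
    using e assms(3) by auto
  moreover have "\<phi> ` V \<subseteq> {1..l}" "inj_on \<phi> V"
    using assms(1) by (simp_all add: ESD_labeling_def)
  ultimately have "\<phi> u \<in> {1..l}" "\<phi> v \<in> {1..l}" "\<phi> u \<noteq> \<phi> v"
    using e(2) by (auto dest: inj_onD)
  then show ?thesis using e by auto
qed

text \<open>The interval has as many elements as there are edges, so an injective weight map into it
  is onto.\<close>

lemma ESD_labeling_weights_eq:
  assumes "ESD_labeling V E l \<phi>" and simple: "\<And>e. e \<in> E \<Longrightarrow> e \<subseteq> V \<and> card e = 2"
    and "card E = 2 * l - 3"
  shows "edge_weight \<phi> ` E = {3..2 * l - 1}"
proof (rule card_subset_eq)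
  show "edge_weight \<phi> ` E \<subseteq> {3..2 * l - 1}"
    using ESD_labeling_weight_bounds[OF assms(1)] simple by blast
  have "inj_on (edge_weight \<phi>) E"
    using assms(1) by (simp add: ESD_labeling_def)
  then show "card (edge_weight \<phi> ` E) = card {3..2 * l - 1}"
    using assms(3) by (simp add: card_image)
qed simp

lemma path_edges_eq_image: "path_edges m = (\<lambda>i. {i, i + 1}) ` {1..<m}"
  by (auto simp: path_edges_def)

lemma star_edges_eq_image: "{{0, v} | v. v \<in> path_verts m} = (\<lambda>v. {0, v}) ` {1..m}"
  by (auto simp: path_verts_def)

text \<open>There are \<open>n - 2\<close> path edges and \<open>n - 1\<close> spokes; no edge is
  both, because 0 is not on the path.\<close>

lemma card_fan_edges:
  assumes "n \<ge> 2"
  shows "card (fan_edges n) = 2 * n - 3"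
proof -
  have "inj_on (\<lambda>i::nat. {i, i + 1}) A" for A
    by (auto simp: inj_on_def doubleton_eq_iff)
  then have "card (path_edges (n - 1)) = n - 2"
    by (simp add: path_edges_eq_image card_image)
  moreover have "inj_on (\<lambda>v::nat. {0, v}) A" for A
    by (auto simp: inj_on_def doubleton_eq_iff)
  then have "card {{0, v} | v. v \<in> path_verts (n - 1)} = n - 1"
    by (simp add: star_edges_eq_image card_image)
  moreover have "path_edges (n - 1) \<inter> {{0, v} | v. v \<in> path_verts (n - 1)} = {}"
    by (auto simp: path_edges_def doubleton_eq_iff)
  moreover have "finite (path_edges (n - 1))" "finite {{0, v} | v. v \<in> path_verts (n - 1)}"
    unfolding path_edges_eq_image star_edges_eq_image by simp_all
  ultimately show ?thesis
    using assms by (simp add: fan_edges_def card_Un_disjoint)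
qed

lemma canonical_ESD_labeling_fan_center_le:
  assumes "n \<ge> 2" and "canonical_ESD_labeling (fan_verts n) (fan_edges n) \<phi>"
  shows "\<phi> 0 \<le> 4"
proof (rule ccontr)
  assume center: "\<not> \<phi> 0 \<le> 4"
  have esd: "ESD_labeling (fan_verts n) (fan_edges n) n \<phi>"
    using assms card_fan_verts[of n] by (simp add: canonical_ESD_labeling_def)
  have img: "\<phi> ` fan_verts n \<subseteq> {1..n}" and inj: "inj_on \<phi> (fan_verts n)"
    using esd by (simp_all add: ESD_labeling_def)
  have "\<phi> 0 \<le> n"
    using img by (auto simp: fan_verts_def)
  then have "n \<ge> 5"
    using center by linarith
  have weights: "edge_weight \<phi> ` fan_edges n = {3..2 * n - 1}"
    by (rule ESD_labeling_weights_eq[OF esd fan_edges_simple card_fan_edges[OF assms(1)]])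
  have pos: "\<phi> i \<ge> 1" if "i \<in> {1..n - 1}" for i
    using img that by (force simp: fan_verts_def path_verts_def)
  have eq: "i = j" if "\<phi> i = \<phi> j" "i \<in> {1..n - 1}" "j \<in> {1..n - 1}" for i j
    using inj that by (auto simp: fan_verts_def path_verts_def dest: inj_onD)
  \<comment> \<open>The endpoints are ordered by label, not by position, so that each weight splits
    in few ways; adjacency must then allow both directions.\<close>
  have path: "\<exists>i j. i \<in> {1..n - 1} \<and> j \<in> {1..n - 1} \<and> (j = i + 1 \<or> i = j + 1)
      \<and> \<phi> i < \<phi> j \<and> \<phi> i + \<phi> j = w" if "w \<in> {3..5}" for w
  proof -
    have "w \<in> edge_weight \<phi> ` fan_edges n"
      unfolding weights using that \<open>n \<ge> 5\<close> by auto
    then obtain e where e: "e \<in> fan_edges n" "edge_weight \<phi> e = w" by blast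
    \<comment> \<open>A spoke weighs at least \<open>5 + 1\<close>, which exceeds
      \<open>w\<close>.\<close>
    have "e \<notin> {{0, v} | v. v \<in> path_verts (n - 1)}"
    proof
      assume "e \<in> {{0, v} | v. v \<in> path_verts (n - 1)}"
      then obtain v where "e = {0, v}" "v \<in> {1..n - 1}"
        by (auto simp: path_verts_def)
      then show False
        using e(2) pos[of v] center that by simp
    qed
    then obtain i where i: "e = {i, i + 1}" "1 \<le> i" "i + 1 \<le> n - 1"
      using e(1) by (auto simp: fan_edges_def path_edges_def)
    then have sum: "\<phi> i + \<phi> (i + 1) = w"
      using e(2) by simp
    have "\<phi> i \<noteq> \<phi> (i + 1)"
      using eq[of i "i + 1"] i by auto
    then consider "\<phi> i < \<phi> (i + 1)" | "\<phi> (i + 1) < \<phi> i"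
      by linarith
    then show ?thesis
    proof cases
      case 1
      then show ?thesis using i sum by (intro exI[of _ i] exI[of _ "i + 1"]) auto
    next
      case 2
      then show ?thesis using i sum by (intro exI[of _ "i + 1"] exI[of _ i]) auto
    qed
  qed
  obtain a b where ab: "a \<in> {1..n - 1}" "b \<in> {1..n - 1}" "b = a + 1 \<or> a = b + 1"
    "\<phi> a < \<phi> b" "\<phi> a + \<phi> b = 3"
    using path[of 3] by auto
  obtain a' d where ad: "a' \<in> {1..n - 1}" "d \<in> {1..n - 1}" "d = a' + 1 \<or> a' = d + 1"
    "\<phi> a' < \<phi> d" "\<phi> a' + \<phi> d = 4"
    using path[of 4] by auto
  obtain p q where pq: "p \<in> {1..n - 1}" "q \<in> {1..n - 1}" "q = p + 1 \<or> p = q + 1"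
    "\<phi> p < \<phi> q" "\<phi> p + \<phi> q = 5"
    using path[of 5] by auto
  \<comment> \<open>With a smaller positive part first, 3 splits only as \<open>1 + 2\<close> and 4
    only as \<open>1 + 3\<close>; both edges therefore share the vertex labeled 1.\<close>
  have vals: "\<phi> a = 1" "\<phi> b = 2" "\<phi> a' = 1" "\<phi> d = 3"
    using ab(4,5) ad(4,5) pos[OF ab(1)] pos[OF ad(1)] by linarith+
  have "a' = a"
    using eq[OF _ ad(1) ab(1)] vals by simp
  have "b \<noteq> d"
    using vals by auto
  have "\<phi> p = 1 \<and> \<phi> q = 4 \<or> \<phi> p = 2 \<and> \<phi> q = 3"
    using pq(4,5) pos[OF pq(1)] by linarith
  then show False
  proof
    assume "\<phi> p = 1 \<and> \<phi> q = 4"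
    then have "p = a" "q \<noteq> b" "q \<noteq> d"
      using eq[OF _ pq(1) ab(1)] vals by auto
    \<comment> \<open>The distinct neighbours \<open>b\<close> and \<open>d\<close> already occupy
      both positions next to \<open>a\<close>, leaving none for \<open>q\<close>.\<close>
    then show False
      using ab(3) ad(3) pq(3) \<open>a' = a\<close> \<open>b \<noteq> d\<close> by auto
  next
    assume "\<phi> p = 2 \<and> \<phi> q = 3"
    then have "p = b" "q = d"
      using eq[OF _ pq(1) ab(2)] eq[OF _ pq(2) ad(2)] vals by auto
    \<comment> \<open>The positions of \<open>b\<close> and \<open>d\<close> lie on opposite sides
      of \<open>a\<close>, so they differ by 2 and are not adjacent.\<close>
    then show False
      using ab(3) ad(3) pq(3) \<open>a' = a\<close> \<open>b \<noteq> d\<close> by auto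
  qed
qed

lemma canonical_ESD_labeling_fan_le:
  assumes "n \<ge> 2" and "canonical_ESD_labeling (fan_verts n) (fan_edges n) \<phi>"
  shows "n \<le> 7"
proof -
  \<comment> \<open>Keeping \<open>card (fan_verts n)\<close> instead of \<open>n\<close> matches
    the unfolded definition of a canonical labeling.\<close>
  have "canonical_ESD_labeling (fan_verts n) (fan_edges n) (\<lambda>v. card (fan_verts n) + 1 - \<phi> v)"
    using assms(2) ESD_labeling_complement fan_edges_simple
    unfolding canonical_ESD_labeling_def by blast
  then have "n + 1 - \<phi> 0 \<le> 4"
    using canonical_ESD_labeling_fan_center_le[OF assms(1)] card_fan_verts[of n] assms(1)
    by fastforce
  moreover have "\<phi> 0 \<le> 4"
    using canonical_ESD_labeling_fan_center_le[OF assms] .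
  ultimately show ?thesis by linarith
qed

text \<open>Reduces a concrete labeling to distinctness of explicit numbers, which simplification
  can evaluate. Entry 0 of \<open>xs\<close> labels the center, the others follow the path.\<close>

lemma canonical_ESD_labeling_fan_of_list:
  assumes "length xs = n" "n \<ge> 1" "distinct xs" "set xs \<subseteq> {1..n}"
    and "distinct (map (\<lambda>i. xs ! i + xs ! (i + 1)) [1..<n - 1] @ map (\<lambda>v. xs ! 0 + xs ! v) [1..<n])"
  shows "canonical_ESD_labeling (fan_verts n) (fan_edges n) ((!) xs)"
proof -
  \<comment> \<open>The last path edge starts at \<open>n - 2\<close>, whereas the spokes reach
    \<open>n - 1\<close>; hence the two different ranges.\<close>
  let ?edges = "map (\<lambda>i. {i, i + 1}) [1..<n - 1] @ map (\<lambda>v. {0, v}) [1..<n]"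
  have verts: "fan_verts n = {..<n}"
    using assms(2) by (auto simp: fan_verts_def path_verts_def)
  have "{1..n - 1} = {1..<n}"
    using assms(2) by auto
  then have edges: "fan_edges n = set ?edges"
    by (simp add: fan_edges_def path_edges_eq_image star_edges_eq_image)
  have "map (edge_weight ((!) xs)) ?edges =
      map (\<lambda>i. xs ! i + xs ! (i + 1)) [1..<n - 1] @ map (\<lambda>v. xs ! 0 + xs ! v) [1..<n]"
    by simp
  then have "distinct (map (edge_weight ((!) xs)) ?edges)"
    using assms(5) by (simp only:)
  then have "inj_on (edge_weight ((!) xs)) (fan_edges n)"
    unfolding edges distinct_map by blast
  moreover have "inj_on ((!) xs) (fan_verts n)"
    using assms(1,3) by (auto simp: verts intro: inj_on_nth)
  moreover have "(!) xs ` fan_verts n \<subseteq> {1..n}"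
    using assms(1,4) by (simp add: verts image_subset_iff subset_code(1))
  ultimately show ?thesis
    using assms(2) by (simp add: canonical_ESD_labeling_def ESD_labeling_def card_fan_verts)
qed

theorem theorem3:
  fixes n :: nat
  assumes "n \<ge> 2"
  shows "\<not> (\<exists>\<phi>. canonical_ESD_labeling (fan_verts n) (fan_edges n) \<phi>) \<longleftrightarrow> n \<ge> 8"
proof
  assume none: "\<not> (\<exists>\<phi>. canonical_ESD_labeling (fan_verts n) (fan_edges n) \<phi>)"
  show "n \<ge> 8"
  proof (rule ccontr)
    assume "\<not> n \<ge> 8"
    then consider "n = 2" | "n = 3" | "n = 4" | "n = 5" | "n = 6" | "n = 7"
      using assms by linarith
    then show False
    proof cases
      case 1
      have "canonical_ESD_labeling (fan_verts 2) (fan_edges 2) ((!) [1, 2])"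
        by (rule canonical_ESD_labeling_fan_of_list) (simp_all add: upt_conv_Cons)
      then show False using none \<open>n = 2\<close> by blast
    next
      case 2
      have "canonical_ESD_labeling (fan_verts 3) (fan_edges 3) ((!) [1, 2, 3])"
        by (rule canonical_ESD_labeling_fan_of_list) (simp_all add: upt_conv_Cons)
      then show False using none \<open>n = 3\<close> by blast
    next
      case 3
      have "canonical_ESD_labeling (fan_verts 4) (fan_edges 4) ((!) [2, 1, 3, 4])"
        by (rule canonical_ESD_labeling_fan_of_list) (simp_all add: upt_conv_Cons)
      then show False using none \<open>n = 4\<close> by blast
    next
      case 4
      have "canonical_ESD_labeling (fan_verts 5) (fan_edges 5) ((!) [3, 1, 2, 4, 5])"
        by (rule canonical_ESD_labeling_fan_of_list) (simp_all add: upt_conv_Cons)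
      then show False using none \<open>n = 5\<close> by blast
    next
      case 5
      have "canonical_ESD_labeling (fan_verts 6) (fan_edges 6) ((!) [3, 1, 2, 4, 6, 5])"
        by (rule canonical_ESD_labeling_fan_of_list) (simp_all add: upt_conv_Cons)
      then show False using none \<open>n = 6\<close> by blast
    next
      case 6
      \<comment> \<open>The bounds on the central label meet here and force it to be 4. The spokes
        miss the weights 3, 4, 8, 12, 13; the segments 3, 1, 2 and 6, 7, 5 supply all but 8, which
        is their link \<open>2 + 6\<close>.\<close>
      have "canonical_ESD_labeling (fan_verts 7) (fan_edges 7) ((!) [4, 3, 1, 2, 6, 7, 5])"
        by (rule canonical_ESD_labeling_fan_of_list) (simp_all add: upt_conv_Cons)
      then show False using none \<open>n = 7\<close> by blast
    qed
  qed
next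
  assume "n \<ge> 8"
  then show "\<not> (\<exists>\<phi>. canonical_ESD_labeling (fan_verts n) (fan_edges n) \<phi>)"
    using canonical_ESD_labeling_fan_le[OF assms] by fastforce
qed

end
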